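(* There is an absolute constant $K>0$ such that the following holds. Let $\mathcal{C}\subset\mathbb{R}^n$ be a compact convex set with $\ell_2$-diameter $D_2=\max_{x,y\in\mathcal{C}}\|x-y\|_2>0$, $x^*\in\mathcal{C}$, $p\in[1,2)$, $\epsilon>0$, and $f(x)=\|x-x^*\|_p$ for $x\in\mathbb{R}^n$. Run the HCGS (Hybrid Conditional Gradient-Smoothing) algorithm on $\min_{x\in\mathcal{C}}f(x)$, started at an arbitrary vertex of $\mathcal{C}$, with step sizes $\gamma_t=\frac{2}{t+2}$ and smoothing parameters $\beta_t=\frac{2D_2}{n^{1/p-1/2}\sqrt{t+2}}$ for all $t\in\mathbb{N}$. Then the algorithm produces an iterate $x\in\mathcal{C}$ satisfying $\|x-x^*\|_p\leq\epsilon$ whose cardinality is $\mathcal{O}(n^{(2-p)/p}D_2^2/\epsilon^2)$, i.e. at most $K\max\{1,n^{(2-p)/p}D_2^2/\epsilon^2\}$.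
   Context: $\|\cdot\|_p$ is the $\ell_p$-norm on $\mathbb{R}^n$ and $\langle\cdot,\cdot\rangle$ the Euclidean inner product. Vertices of $\mathcal{C}$ are its extreme points. For a convex continuous $f\colon\mathbb{R}^n\to\mathbb{R}$ and $\beta>0$, the Moreau envelope is $f_\beta(x)=\min_{y\in\mathbb{R}^n}f(y)+\frac{1}{2\beta}\|x-y\|_2^2$; it is convex and differentiable with $\nabla f_\beta(x)=\frac1\beta(x-\operatorname{prox}_{\beta f}(x))$, where $\operatorname{prox}_{g}(x)=\arg\min_{y\in\mathbb{R}^n}g(y)+\frac12\|x-y\|_2^2$. HCGS: start at a vertex $x_0$ of $\mathcal{C}$; for $t=0,1,2,\ldots$ let $v_t$ be a vertex of $\mathcal{C}$ belonging to $\arg\min_{v\in\mathcal{C}}\langle v,\nabla f_{\beta_t}(x_t)\rangle$, and set $x_{t+1}=x_t+\gamma_t(v_t-x_t)$. Each iterate $x_{t+1}=(1-\gamma_t)x_t+\gamma_tv_t$ comes with an explicit convex decomposition over $x_0,v_0,\ldots,v_t$. The cardinality of an iterate is the number of distinct vertices with positive weight in this decomposition. *)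

theory Defs
  imports "HOL-Analysis.Analysis"
begin

text \<open>
  The constant of the theorem must not depend on the dimension, so the dimension has to be a
  number that can be quantified inside a formula. Therefore all the spaces \<open>\<real>\<^sup>n\<close> are realised
  as subspaces of one real inner product space: the finitely supported real sequences with
  \<open>x \<bullet> y = (\<Sum>i. x\<^sub>i y\<^sub>i)\<close>, in which \<open>\<real>\<^sup>n\<close> consists of the sequences vanishing from index \<open>n\<close> on.
  The norm of this space restricts to the Euclidean norm of \<open>\<real>\<^sup>n\<close>.
\<close>

typedef fseq = "{x :: nat \<Rightarrow> real. finite {i. x i \<noteq> 0}}"
  morphisms coord Abs_fseq
  by (rule exI[of _ "\<lambda>_. 0"]) simp

setup_lifting type_definition_fseq

lemma finite_coord: "finite {i. coord x i \<noteq> 0}"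
  using coord[of x] by simp

lemma fseq_eqI: "(\<And>i. coord x i = coord y i) \<Longrightarrow> x = y"
  by (simp add: coord_inject[symmetric] fun_eq_iff)

instantiation fseq :: real_vector
begin

lift_definition zero_fseq :: fseq is "\<lambda>_. 0" by simp

lift_definition plus_fseq :: "fseq \<Rightarrow> fseq \<Rightarrow> fseq" is "\<lambda>x y i. x i + y i"
  subgoal for x y by (rule finite_subset[of _ "{i. x i \<noteq> 0} \<union> {i. y i \<noteq> 0}"]) auto
  done

lift_definition minus_fseq :: "fseq \<Rightarrow> fseq \<Rightarrow> fseq" is "\<lambda>x y i. x i - y i"
  subgoal for x y by (rule finite_subset[of _ "{i. x i \<noteq> 0} \<union> {i. y i \<noteq> 0}"]) auto
  done

lift_definition uminus_fseq :: "fseq \<Rightarrow> fseq" is "\<lambda>x i. - x i" by simp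

lift_definition scaleR_fseq :: "real \<Rightarrow> fseq \<Rightarrow> fseq" is "\<lambda>c x i. c * x i"
  by (rule rev_finite_subset) auto

instance
  by standard (transfer; simp add: fun_eq_iff algebra_simps)+

end

instantiation fseq :: real_inner
begin

definition inner_fseq :: "fseq \<Rightarrow> fseq \<Rightarrow> real" where
  "inner_fseq x y = (\<Sum>i | coord x i \<noteq> 0. coord x i * coord y i)"

definition norm_fseq :: "fseq \<Rightarrow> real" where
  "norm_fseq x = sqrt (inner x x)"

definition sgn_fseq :: "fseq \<Rightarrow> fseq" where
  "sgn_fseq x = x /\<^sub>R norm x"

definition dist_fseq :: "fseq \<Rightarrow> fseq \<Rightarrow> real" where
  "dist_fseq x y = norm (x - y)"

definition uniformity_fseq :: "(fseq \<times> fseq) filter" where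
  "uniformity_fseq = (INF e\<in>{0<..}. principal {(x, y). dist x y < e})"

definition open_fseq :: "fseq set \<Rightarrow> bool" where
  "open_fseq U \<longleftrightarrow> (\<forall>x\<in>U. eventually (\<lambda>(x', y). x' = x \<longrightarrow> y \<in> U) uniformity)"

lemma inner_fseq_superset:
  assumes "finite A" "{i. coord x i \<noteq> 0} \<subseteq> A"
  shows "inner x y = (\<Sum>i\<in>A. coord x i * coord y i)"
  unfolding inner_fseq_def using assms by (intro sum.mono_neutral_left) auto

instance
proof
  fix x y z :: fseq and r :: real
  let ?A = "{i. coord x i \<noteq> 0} \<union> {i. coord y i \<noteq> 0} \<union> {i. coord (x + y) i \<noteq> 0}
              \<union> {i. coord (r *\<^sub>R x) i \<noteq> 0}"
  have fin: "finite ?A" by (simp add: finite_coord)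
  show "inner x y = inner y x"
    by (subst (1 2) inner_fseq_superset[OF fin]) (auto simp: mult.commute)
  show "inner (x + y) z = inner x z + inner y z"
    by (subst (1 2 3) inner_fseq_superset[OF fin])
       (auto simp: plus_fseq.rep_eq distrib_right sum.distrib)
  show "inner (r *\<^sub>R x) y = r * inner x y"
    by (subst (1 2) inner_fseq_superset[OF fin])
       (auto simp: scaleR_fseq.rep_eq sum_distrib_left mult.assoc)
  show "0 \<le> inner x x"
    by (auto simp: inner_fseq_def intro: sum_nonneg)
  show "inner x x = 0 \<longleftrightarrow> x = 0"
  proof
    assume "inner x x = 0"
    then have "\<forall>i\<in>{i. coord x i \<noteq> 0}. coord x i * coord x i = 0"
      unfolding inner_fseq_def by (subst (asm) sum_nonneg_eq_0_iff) (auto simp: finite_coord)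
    then show "x = 0" by (intro fseq_eqI) (auto simp: zero_fseq.rep_eq)
  qed (simp add: inner_fseq_def zero_fseq.rep_eq)
qed (fact norm_fseq_def sgn_fseq_def dist_fseq_def uniformity_fseq_def open_fseq_def)+

end

definition Rn :: "nat \<Rightarrow> fseq set" where
  "Rn n = {x. \<forall>i\<ge>n. coord x i = 0}"

definition lp_norm :: "nat \<Rightarrow> real \<Rightarrow> fseq \<Rightarrow> real" where
  "lp_norm n p x = (\<Sum>i<n. \<bar>coord x i\<bar> powr p) powr (1 / p)"

text \<open>
  For convex continuous \<open>f\<close> and \<open>\<beta> > 0\<close> the infimum is attained, so it is the minimum defining
  the Moreau envelope.
\<close>

definition moreau_env :: "nat \<Rightarrow> (fseq \<Rightarrow> real) \<Rightarrow> real \<Rightarrow> fseq \<Rightarrow> real" where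
  "moreau_env n f \<beta> x = (INF y\<in>Rn n. f y + 1 / (2 * \<beta>) * (norm (x - y))\<^sup>2)"

text \<open>
  The derivative is taken within \<open>\<real>\<^sup>n\<close>, which determines its representing vector in \<open>\<real>\<^sup>n\<close>
  uniquely.
\<close>

definition grad :: "nat \<Rightarrow> (fseq \<Rightarrow> real) \<Rightarrow> fseq \<Rightarrow> fseq" where
  "grad n F x =
     (THE g. g \<in> Rn n \<and> (F has_derivative (\<lambda>h. h \<bullet> g)) (at x within Rn n))"

text \<open>
  Vertices and subproblem solutions may be chosen arbitrarily: the predicate describes all
  possible runs, with iterates \<open>x\<close> and oracle answers \<open>v\<close>.
\<close>

definition hcgs_run ::
  "nat \<Rightarrow> fseq set \<Rightarrow> (fseq \<Rightarrow> real) \<Rightarrow> (nat \<Rightarrow> real) \<Rightarrow> (nat \<Rightarrow> real) \<Rightarrow>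
    (nat \<Rightarrow> fseq) \<Rightarrow> (nat \<Rightarrow> fseq) \<Rightarrow> bool" where
  "hcgs_run n C f \<gamma> \<beta> x v \<longleftrightarrow>
     x 0 extreme_point_of C \<and>
     (\<forall>t. v t extreme_point_of C \<and>
          is_arg_min (\<lambda>u. u \<bullet> grad n (moreau_env n f (\<beta> t)) (x t)) (\<lambda>u. u \<in> C) (v t) \<and>
          x (Suc t) = x t + \<gamma> t *\<^sub>R (v t - x t))"

text \<open>
  Weight of the vertex \<open>u\<close> in the convex decomposition of the \<open>t\<close>-th iterate obtained by
  unfolding \<open>x\<^sub>t\<^sub>+\<^sub>1 = (1 - \<gamma>\<^sub>t) x\<^sub>t + \<gamma>\<^sub>t v\<^sub>t\<close> from \<open>x\<^sub>0\<close>; the weights of repeated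
  occurrences of a vertex are added.
\<close>

primrec hcgs_weight ::
  "(nat \<Rightarrow> real) \<Rightarrow> fseq \<Rightarrow> (nat \<Rightarrow> fseq) \<Rightarrow> nat \<Rightarrow> fseq \<Rightarrow> real" where
  "hcgs_weight \<gamma> x0 v 0 u = (if u = x0 then 1 else 0)"
| "hcgs_weight \<gamma> x0 v (Suc t) u =
     (1 - \<gamma> t) * hcgs_weight \<gamma> x0 v t u + \<gamma> t * (if u = v t then 1 else 0)"

definition iterate_cardinality ::
  "(nat \<Rightarrow> real) \<Rightarrow> fseq \<Rightarrow> (nat \<Rightarrow> fseq) \<Rightarrow> nat \<Rightarrow> nat" where
  "iterate_cardinality \<gamma> x0 v t = card {u. hcgs_weight \<gamma> x0 v t u > 0}"

end

theory Submission
  imports Defs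
begin

text \<open>
  Write \<open>D\<close> for the diameter of \<open>C\<close> and \<open>L = n powr (1 / p - 1 / 2)\<close>. The iterate with index \<open>t\<close> is supported on at
  most \<open>t + 1\<close> vertices (\<open>iterate_cardinality_le\<close>), so it suffices that \<open>f(x\<^sub>t)\<close> is of order
  \<open>D L / \<surd>t\<close>: this drops below \<open>\<epsilon>\<close> once \<open>t\<close> is of order \<open>D\<^sup>2 L\<^sup>2 / \<epsilon>\<^sup>2\<close>, and
  \<open>L\<^sup>2 = n powr ((2 - p) / p)\<close>. The objective \<open>lp_norm n p (x - xstar)\<close> enters only through being convex (Minkowski's
  inequality, \<open>lp_norm_triangle\<close>) and \<open>L\<close>-Lipschitz for the Euclidean norm (Jensen's inequality,
  \<open>lp_norm_le_norm\<close>), and through its minimum being \<open>0\<close>.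

  For a convex \<open>L\<close>-Lipschitz \<open>f\<close> the rate is \<open>hcgs_convergence\<close>. The envelope with parameter
  \<open>\<beta>\<close> has a \<open>1 / \<beta>\<close>-Lipschitz gradient and lies below \<open>f\<close> by at most \<open>\<beta> L\<^sup>2 / 2\<close>
  (\<open>moreau_env_upper\<close>, \<open>moreau_env_lower\<close>, \<open>le_moreau_env\<close>). The Frank-Wolfe step on the
  \<open>t\<close>-th envelope contracts the gap by \<open>1 - \<gamma>\<^sub>t = t / (t + 2)\<close> up to an error
  \<open>\<gamma>\<^sub>t\<^sup>2 D\<^sup>2 / (2 \<beta>\<^sub>t)\<close> (\<open>frank_wolfe_step\<close>), and passing to the next envelope costs only a multiple
  of \<open>\<beta>\<^sub>t - \<beta>\<^sub>t\<^sub>+\<^sub>1\<close> (\<open>moreau_env_decrease_parameter\<close>). Both errors are of order \<open>D L / (t \<surd>t)\<close>, and the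
  resulting recurrence keeps the gap of order \<open>D L / \<surd>t\<close> (\<open>gap_recurrence_bound\<close>); the smoothing gap
  \<open>\<beta>\<^sub>t L\<^sup>2 / 2\<close> is of the same order.
\<close>

section \<open>The coordinate subspaces\<close>

lemma coord_simps [simp]:
  "coord 0 i = 0"
  "coord (x + y) i = coord x i + coord y i"
  "coord (x - y) i = coord x i - coord y i"
  "coord (- x) i = - coord x i"
  "coord (c *\<^sub>R x) i = c * coord x i"
  by (simp_all add: zero_fseq.rep_eq plus_fseq.rep_eq minus_fseq.rep_eq
      uminus_fseq.rep_eq scaleR_fseq.rep_eq)

lift_definition unit_vec :: "nat \<Rightarrow> fseq" is "\<lambda>k i. if i = k then 1 else 0"
  by simp

lemma coord_unit_vec [simp]: "coord (unit_vec k) i = (if i = k then 1 else 0)"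
  by (simp add: unit_vec.rep_eq)

lemma coord_eq_inner: "coord x i = x \<bullet> unit_vec i"
proof -
  have "x \<bullet> unit_vec i = unit_vec i \<bullet> x"
    by (rule inner_commute)
  also have "\<dots> = (\<Sum>j\<in>{i}. coord (unit_vec i) j * coord x j)"
    by (rule inner_fseq_superset) auto
  finally show ?thesis by simp
qed

lemma abs_coord_le_norm: "\<bar>coord x i\<bar> \<le> norm x"
proof -
  have "unit_vec i \<bullet> unit_vec i = 1"
    by (simp flip: coord_eq_inner)
  then have "norm (unit_vec i) = 1"
    by (simp add: norm_eq_sqrt_inner)
  then show ?thesis
    using Cauchy_Schwarz_ineq2[of x "unit_vec i"] by (simp add: coord_eq_inner)
qed

lemma subspace_Rn: "subspace (Rn n)"
  by (auto simp: subspace_def Rn_def)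

lemmas Rn_add = subspace_add[OF subspace_Rn]
  and Rn_diff = subspace_diff[OF subspace_Rn]
  and Rn_scale = subspace_scale[OF subspace_Rn]

lemma convex_Rn: "convex (Rn n)"
  by (rule subspace_imp_convex[OF subspace_Rn])

lemma norm_power2_Rn:
  assumes "x \<in> Rn n"
  shows "(norm x)\<^sup>2 = (\<Sum>i<n. (coord x i)\<^sup>2)"
  using assms
  by (subst power2_norm_eq_inner, subst inner_fseq_superset[of "{..<n}"])
     (auto simp: Rn_def power2_eq_square not_le[symmetric])

text \<open>
  The ambient space of all finitely supported sequences is not locally compact, so compactness
  is built up one dimension at a time: a box in \<open>\<real>\<^sup>n\<^sup>+\<^sup>1\<close> is a continuous image of the product of
  a box in \<open>\<real>\<^sup>n\<close> with an interval.
\<close>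

lemma compact_Rn_box: "compact {x \<in> Rn n. \<forall>i. \<bar>coord x i\<bar> \<le> r}"
proof (cases "r \<ge> 0")
  case True
  show ?thesis
  proof (induction n)
    case 0
    have "{x \<in> Rn 0. \<forall>i. \<bar>coord x i\<bar> \<le> r} \<subseteq> {0}"
      by (auto simp: Rn_def intro: fseq_eqI)
    then have "finite {x \<in> Rn 0. \<forall>i. \<bar>coord x i\<bar> \<le> r}"
      by (rule finite_subset) simp
    then show ?case by (rule finite_imp_compact)
  next
    case (Suc n)
    let ?B = "\<lambda>n. {x \<in> Rn n. \<forall>i. \<bar>coord x i\<bar> \<le> r}"
    let ?g = "\<lambda>(x, c). x + c *\<^sub>R unit_vec n"
    have "x \<in> ?g ` (?B n \<times> {-r..r})" if x: "x \<in> ?B (Suc n)" for x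
    proof (rule image_eqI)
      show "x = ?g (x - coord x n *\<^sub>R unit_vec n, coord x n)" by simp
      show "(x - coord x n *\<^sub>R unit_vec n, coord x n) \<in> ?B n \<times> {-r..r}"
        using x True by (auto simp: Rn_def Suc_le_eq abs_le_iff minus_le_iff)
    qed
    moreover have "?g ` (?B n \<times> {-r..r}) \<subseteq> ?B (Suc n)"
      by (auto simp: Rn_def abs_le_iff)
    ultimately have "?B (Suc n) = ?g ` (?B n \<times> {-r..r})" by blast
    moreover have "compact (?g ` (?B n \<times> {-r..r}))"
      by (intro compact_continuous_image compact_Times Suc.IH compact_Icc)
         (auto simp: case_prod_beta intro!: continuous_intros)
    ultimately show ?case by simp
  qed
next
  case False
  then have "{x \<in> Rn n. \<forall>i. \<bar>coord x i\<bar> \<le> r} = {}"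
    by (smt (verit) Collect_empty_eq abs_ge_zero)
  then show ?thesis by (simp only: compact_empty)
qed

text \<open>
  The derivative within \<open>\<real>\<^sup>n\<close> has a unique representing vector in \<open>\<real>\<^sup>n\<close>, so exhibiting one
  evaluates the definite description in the definition of the gradient.
\<close>

lemma grad_eqI:
  assumes x: "x \<in> Rn n" and g: "g \<in> Rn n"
    and der: "(F has_derivative (\<lambda>h. h \<bullet> g)) (at x within Rn n)"
  shows "grad n F x = g"
  unfolding grad_def
proof (rule the_equality)
  show "g \<in> Rn n \<and> (F has_derivative (\<lambda>h. h \<bullet> g)) (at x within Rn n)"
    using g der by simp
next
  fix g' assume g': "g' \<in> Rn n \<and> (F has_derivative (\<lambda>h. h \<bullet> g')) (at x within Rn n)"
  \<comment> \<open>Both linear forms are determined along the line in the direction \<open>g' - g\<close>, which stays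
    in \<open>\<real>\<^sup>n\<close>.\<close>
  define l where "l = (\<lambda>t::real. x + t *\<^sub>R (g' - g))"
  have "((\<lambda>t. F (l t)) has_derivative (\<lambda>t. (t *\<^sub>R (g' - g)) \<bullet> a)) (at 0)"
    if "(F has_derivative (\<lambda>h. h \<bullet> a)) (at x within Rn n)" for a
  proof (rule has_derivative_in_compose[where f = l and g = F and g' = "\<lambda>h. h \<bullet> a"])
    show "(l has_derivative (\<lambda>t. t *\<^sub>R (g' - g))) (at 0)"
      unfolding l_def by (auto intro!: derivative_eq_intros)
    have "range l \<subseteq> Rn n"
      unfolding l_def using x g g' by (auto intro!: Rn_add Rn_scale Rn_diff)
    then show "(F has_derivative (\<lambda>h. h \<bullet> a)) (at (l 0) within l ` UNIV)"
      using that by (auto simp: l_def intro: has_derivative_subset)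
  qed
  then have "(\<lambda>t. (t *\<^sub>R (g' - g)) \<bullet> g) = (\<lambda>t. (t *\<^sub>R (g' - g)) \<bullet> g')"
    using der g' by (intro has_derivative_unique) auto
  from fun_cong[OF this, of 1] have "(g' - g) \<bullet> (g' - g) = 0"
    by (simp add: inner_diff_right)
  then show "g' = g" by simp
qed

section \<open>The lp norm\<close>

text \<open>
  Convexity on the closed half-line, as vectors may have vanishing coordinates. When one of the two
  points is \<open>0\<close> the claim is \<open>(s z)\<^sup>p \<le> s z\<^sup>p\<close>.
\<close>

lemma convex_on_powr_atLeast_0:
  fixes p :: real
  assumes p: "p \<ge> 1"
  shows "convex_on {0..} (\<lambda>x. x powr p)"
proof (rule convex_onI)
  fix t x y :: real
  assume t: "0 < t" "t < 1" and xy: "x \<in> {0..}" "y \<in> {0..}"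
  have scale: "(s * z) powr p \<le> s * z powr p" if "0 < s" "s < 1" "z \<ge> 0" for s z :: real
  proof -
    have "s powr p \<le> s powr 1"
      using that p by (intro powr_mono') auto
    then show ?thesis
      using that by (simp add: powr_mult mult_right_mono)
  qed
  show "((1 - t) *\<^sub>R x + t *\<^sub>R y) powr p \<le> (1 - t) * x powr p + t * y powr p"
  proof (cases "x = 0 \<or> y = 0")
    case True
    then show ?thesis
      using scale[of t y] scale[of "1 - t" x] t xy by auto
  next
    case False
    then show ?thesis
      using convex_onD[OF powr_convex[OF p], of t x y] t xy by auto
  qed
qed simp

lemma lp_norm_nonneg: "lp_norm n p x \<ge> 0"
  by (simp add: lp_norm_def)

lemma lp_norm_powr:
  assumes "p > 0"
  shows "lp_norm n p x powr p = (\<Sum>i<n. \<bar>coord x i\<bar> powr p)"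
  using assms by (simp add: lp_norm_def powr_powr sum_nonneg)

lemma lp_norm_scale:
  assumes "p > 0"
  shows "lp_norm n p (c *\<^sub>R x) = \<bar>c\<bar> * lp_norm n p x"
proof -
  have "(\<Sum>i<n. \<bar>coord (c *\<^sub>R x) i\<bar> powr p) = \<bar>c\<bar> powr p * (\<Sum>i<n. \<bar>coord x i\<bar> powr p)"
    by (simp add: abs_mult powr_mult sum_distrib_left)
  then show ?thesis
    using assms by (simp add: lp_norm_def powr_mult powr_powr sum_nonneg)
qed

text \<open>
  Minkowski's inequality. The \<open>p\<close>-th power is convex, so the unit ball of the norm is convex;
  with \<open>A\<close> and \<open>B\<close> the norms of \<open>x\<close> and \<open>y\<close>, the vector \<open>(x + y) / (A + B)\<close> is a convex
  combination of \<open>x / A\<close> and \<open>y / B\<close>, which lie in that ball. Enlarging both norms by \<open>e / 2\<close>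
  avoids division by \<open>0\<close>.
\<close>

lemma lp_norm_triangle:
  assumes p: "p \<ge> 1"
  shows "lp_norm n p (x + y) \<le> lp_norm n p x + lp_norm n p y"
proof (rule field_le_epsilon)
  fix e :: real assume e: "e > 0"
  define A B where "A = lp_norm n p x + e / 2" and "B = lp_norm n p y + e / 2"
  have AB: "A > 0" "B > 0"
    using e lp_norm_nonneg by (auto simp: A_def B_def add_nonneg_pos)
  have sum_le: "(\<Sum>i<n. (\<bar>coord z i\<bar> / r) powr p) \<le> 1"
    if "r > 0" "lp_norm n p z \<le> r" for z r
  proof -
    have "(\<Sum>i<n. (\<bar>coord z i\<bar> / r) powr p) = lp_norm n p z powr p / r powr p"
      using that p by (simp add: lp_norm_powr powr_divide sum_divide_distrib)
    also have "\<dots> \<le> 1"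
      using that p lp_norm_nonneg by (simp add: powr_mono2)
    finally show ?thesis .
  qed
  have pointwise: "(\<bar>coord (x + y) i\<bar> / (A + B)) powr p
      \<le> A / (A + B) * (\<bar>coord x i\<bar> / A) powr p + B / (A + B) * (\<bar>coord y i\<bar> / B) powr p" for i
  proof -
    have eq: "1 - B / (A + B) = A / (A + B)" using AB by (simp add: field_simps)
    have "(\<bar>coord (x + y) i\<bar> / (A + B)) powr p \<le> ((\<bar>coord x i\<bar> + \<bar>coord y i\<bar>) / (A + B)) powr p"
      using AB p by (intro powr_mono2 divide_right_mono) auto
    also have "(\<bar>coord x i\<bar> + \<bar>coord y i\<bar>) / (A + B)
        = A / (A + B) * (\<bar>coord x i\<bar> / A) + B / (A + B) * (\<bar>coord y i\<bar> / B)"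
      using AB by (simp add: add_divide_distrib)
    also have "\<dots> powr p
        \<le> A / (A + B) * (\<bar>coord x i\<bar> / A) powr p + B / (A + B) * (\<bar>coord y i\<bar> / B) powr p"
      using convex_onD[OF convex_on_powr_atLeast_0[OF p], of "B / (A + B)" "\<bar>coord x i\<bar> / A"
          "\<bar>coord y i\<bar> / B"] AB
      by (simp add: eq)
    finally show ?thesis .
  qed
  have "(\<Sum>i<n. (\<bar>coord (x + y) i\<bar> / (A + B)) powr p)
      \<le> A / (A + B) * (\<Sum>i<n. (\<bar>coord x i\<bar> / A) powr p)
        + B / (A + B) * (\<Sum>i<n. (\<bar>coord y i\<bar> / B) powr p)"
    unfolding sum_distrib_left sum.distrib[symmetric] by (intro sum_mono pointwise)
  also have "\<dots> \<le> A / (A + B) * 1 + B / (A + B) * 1"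
    using AB e by (intro add_mono mult_left_mono sum_le) (auto simp: A_def B_def)
  also have "\<dots> = 1"
    using AB by (simp add: add_divide_distrib[symmetric])
  finally have "lp_norm n p (x + y) powr p \<le> (A + B) powr p"
    using AB p by (simp add: lp_norm_powr powr_divide sum_divide_distrib[symmetric])
  then have "lp_norm n p (x + y) \<le> A + B"
    using AB p lp_norm_nonneg[of n p "x + y"] powr_less_mono2[of p "A + B" "lp_norm n p (x + y)"]
    by force
  then show "lp_norm n p (x + y) \<le> lp_norm n p x + lp_norm n p y + e"
    by (simp add: A_def B_def)
qed

lemma convex_on_lp_norm_diff:
  assumes p: "p \<ge> 1"
  shows "convex_on (Rn n) (\<lambda>y. lp_norm n p (y - c))"
proof (rule convex_onI)
  fix t :: real and x y assume t: "0 < t" "t < 1"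
  have "(1 - t) *\<^sub>R x + t *\<^sub>R y - c = (1 - t) *\<^sub>R (x - c) + t *\<^sub>R (y - c)"
    by (simp add: algebra_simps)
  then show "lp_norm n p ((1 - t) *\<^sub>R x + t *\<^sub>R y - c)
      \<le> (1 - t) * lp_norm n p (x - c) + t * lp_norm n p (y - c)"
    using lp_norm_triangle[OF p, of n "(1 - t) *\<^sub>R (x - c)" "t *\<^sub>R (y - c)"] t p
    by (simp add: lp_norm_scale)
qed (rule convex_Rn)

text \<open>
  Jensen's inequality for the power \<open>2 / p \<ge> 1\<close>, applied to the average of the numbers
  \<open>\<bar>x\<^sub>i\<bar>\<^sup>p\<close>.
\<close>

lemma lp_norm_le_norm:
  assumes p: "1 \<le> p" "p \<le> 2" and x: "x \<in> Rn n"
  shows "lp_norm n p x \<le> real n powr (1 / p - 1 / 2) * norm x"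
proof (cases "n = 0")
  case True
  then show ?thesis by (simp add: lp_norm_def)
next
  case False
  define S where "S = (\<Sum>i<n. \<bar>coord x i\<bar> powr p)"
  have S: "S \<ge> 0" by (simp add: S_def sum_nonneg)
  have "(\<Sum>i<n. (1 / real n) *\<^sub>R (\<bar>coord x i\<bar> powr p)) powr (2 / p)
      \<le> (\<Sum>i<n. (1 / real n) * (\<bar>coord x i\<bar> powr p) powr (2 / p))"
    using False p
    by (intro convex_on_sum[OF _ _ convex_on_powr_atLeast_0]) auto
  also have "\<dots> = (\<Sum>i<n. (coord x i)\<^sup>2) / real n"
    using p by (simp add: powr_powr sum_divide_distrib[symmetric])
  also have "\<dots> = (norm x)\<^sup>2 / real n"
    by (simp add: norm_power2_Rn[OF x])
  also have "(\<Sum>i<n. (1 / real n) *\<^sub>R (\<bar>coord x i\<bar> powr p)) = S / real n"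
    by (simp add: S_def sum_divide_distrib[symmetric])
  finally have le: "(S / real n) powr (2 / p) \<le> (norm x)\<^sup>2 / real n" .
  have "lp_norm n p x = real n powr (1 / p) * (S / real n) powr (1 / p)"
    using False S by (simp add: lp_norm_def S_def[symmetric] powr_divide)
  also have "(S / real n) powr (1 / p) = sqrt ((S / real n) powr (2 / p))"
    using S by (simp add: powr_half_sqrt[symmetric] powr_powr)
  also have "\<dots> \<le> sqrt ((norm x)\<^sup>2 / real n)"
    using le by simp
  also have "\<dots> = norm x * real n powr (- (1 / 2))"
    unfolding powr_minus_divide powr_half_sqrt[OF of_nat_0_le_iff] by (simp add: real_sqrt_divide)
  finally have "lp_norm n p x \<le> real n powr (1 / p) * (norm x * real n powr (- (1 / 2)))"
    by (simp add: mult_left_mono)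
  also have "\<dots> = real n powr (1 / p - 1 / 2) * norm x"
    unfolding diff_conv_add_uminus powr_add by simp
  finally show ?thesis .
qed

lemma lipschitz_on_lp_norm_diff:
  assumes p: "1 \<le> p" "p \<le> 2"
  shows "(real n powr (1 / p - 1 / 2))-lipschitz_on (Rn n) (\<lambda>y. lp_norm n p (y - c))"
proof (rule lipschitz_onI)
  fix x y assume "x \<in> Rn n" "y \<in> Rn n"
  have le: "lp_norm n p (a - c) - lp_norm n p (b - c) \<le> real n powr (1 / p - 1 / 2) * dist a b"
    if "a \<in> Rn n" "b \<in> Rn n" for a b
    using lp_norm_triangle[OF p(1), of n "a - b" "b - c"] lp_norm_le_norm[OF p Rn_diff[OF that]]
    by (simp add: dist_norm)
  show "dist (lp_norm n p (x - c)) (lp_norm n p (y - c))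
      \<le> real n powr (1 / p - 1 / 2) * dist x y"
    using le[of x y] le[of y x] \<open>x \<in> Rn n\<close> \<open>y \<in> Rn n\<close>
    by (auto simp: dist_real_def dist_commute abs_if)
qed simp

section \<open>The Moreau envelope\<close>

definition prox :: "nat \<Rightarrow> (fseq \<Rightarrow> real) \<Rightarrow> real \<Rightarrow> fseq \<Rightarrow> fseq" where
  "prox n f \<beta> x =
     (SOME q. is_arg_min (\<lambda>y. f y + 1 / (2 * \<beta>) * (norm (x - y))\<^sup>2) (\<lambda>y. y \<in> Rn n) q)"

locale lipschitz_convex =
  fixes n :: nat and f :: "fseq \<Rightarrow> real" and L :: real
  assumes convex: "convex_on (Rn n) f"
    and lipschitz: "L-lipschitz_on (Rn n) f"
begin

lemma lipschitzD:
  assumes "x \<in> Rn n" "y \<in> Rn n"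
  shows "f x - f y \<le> L * norm (x - y)"
  using lipschitz_on_normD[OF lipschitz assms] by simp

text \<open>
  The Lipschitz condition makes the quadratic term dominate at distances above \<open>2 \<beta> L\<close> from
  \<open>x\<close>, so that the infimum is attained on a compact box.
\<close>

lemma prox_is_arg_min:
  assumes \<beta>: "\<beta> > 0" and x: "x \<in> Rn n"
  shows "is_arg_min (\<lambda>y. f y + 1 / (2 * \<beta>) * (norm (x - y))\<^sup>2) (\<lambda>y. y \<in> Rn n) (prox n f \<beta> x)"
proof -
  define \<phi> where "\<phi> = (\<lambda>y. f y + 1 / (2 * \<beta>) * (norm (x - y))\<^sup>2)"
  define R where "R = norm x + 2 * \<beta> * L"
  let ?B = "{y \<in> Rn n. \<forall>i. \<bar>coord y i\<bar> \<le> R}"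
  have L: "L \<ge> 0" using lipschitz by (rule lipschitz_on_nonneg)
  have "\<bar>coord x i\<bar> \<le> R" for i
    using abs_coord_le_norm[of x i] \<beta> L by (simp add: R_def add_increasing2)
  with x have xB: "x \<in> ?B" by simp
  have "continuous_on ?B f"
    using lipschitz_on_continuous_on[OF lipschitz] by (rule continuous_on_subset) auto
  then have "continuous_on ?B \<phi>"
    unfolding \<phi>_def by (intro continuous_intros)
  then obtain q where q: "q \<in> ?B" "\<And>y. y \<in> ?B \<Longrightarrow> \<phi> q \<le> \<phi> y"
    using continuous_attains_inf[OF compact_Rn_box, of n R \<phi>] xB by blast
  have "\<phi> q \<le> \<phi> y" if y: "y \<in> Rn n" for y
  proof (cases "y \<in> ?B")
    case False
    then obtain i where "\<bar>coord y i\<bar> > R" using y by (auto simp: not_le)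
    then have "norm y > norm x + 2 * \<beta> * L"
      using abs_coord_le_norm[of y i] by (simp add: R_def)
    then have far: "2 * \<beta> * L \<le> norm (x - y)"
      using norm_triangle_ineq2[of y x] by (simp add: norm_minus_commute)
    have "f x \<le> f y + L * norm (x - y)"
      using lipschitzD[OF x y] by simp
    also have "L * norm (x - y) \<le> 1 / (2 * \<beta>) * (norm (x - y))\<^sup>2"
      using mult_right_mono[OF far norm_ge_zero[of "x - y"]] \<beta>
      by (simp add: power2_eq_square field_simps)
    finally have "\<phi> x \<le> \<phi> y" by (simp add: \<phi>_def)
    with q(2)[OF xB] show ?thesis by simp
  qed (rule q)
  then have "is_arg_min \<phi> (\<lambda>y. y \<in> Rn n) q"
    using q(1) by (auto simp: is_arg_min_def not_less)
  then show ?thesis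
    unfolding prox_def \<phi>_def by (rule someI)
qed

lemma prox_in_Rn: "\<beta> > 0 \<Longrightarrow> x \<in> Rn n \<Longrightarrow> prox n f \<beta> x \<in> Rn n"
  using prox_is_arg_min by (simp add: is_arg_min_def)

lemma prox_le:
  assumes "\<beta> > 0" "x \<in> Rn n" "y \<in> Rn n"
  shows "f (prox n f \<beta> x) + 1 / (2 * \<beta>) * (norm (x - prox n f \<beta> x))\<^sup>2
      \<le> f y + 1 / (2 * \<beta>) * (norm (x - y))\<^sup>2"
  using prox_is_arg_min[OF assms(1,2)] assms(3) by (force simp: is_arg_min_def)

lemma moreau_env_eq:
  assumes "\<beta> > 0" "x \<in> Rn n"
  shows "moreau_env n f \<beta> x
    = f (prox n f \<beta> x) + 1 / (2 * \<beta>) * (norm (x - prox n f \<beta> x))\<^sup>2"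
  unfolding moreau_env_def
  using prox_le[OF assms] prox_in_Rn[OF assms] by (intro cInf_eq_minimum) auto

lemma moreau_env_le:
  assumes "\<beta> > 0" "x \<in> Rn n" "y \<in> Rn n"
  shows "moreau_env n f \<beta> x \<le> f y + 1 / (2 * \<beta>) * (norm (x - y))\<^sup>2"
  using prox_le[OF assms] by (simp add: moreau_env_eq assms)

lemma moreau_env_le_self:
  assumes "\<beta> > 0" "x \<in> Rn n"
  shows "moreau_env n f \<beta> x \<le> f x"
  using moreau_env_le[OF assms assms(2)] by simp

text \<open>
  First-order optimality: compare the prox point \<open>q\<close> with the points of the segment from \<open>q\<close> to
  \<open>y\<close>, and let these tend to \<open>q\<close>.
\<close>

lemma prox_subgradient:
  assumes \<beta>: "\<beta> > 0" and x: "x \<in> Rn n" and y: "y \<in> Rn n"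
  defines "q \<equiv> prox n f \<beta> x"
  shows "f q + (y - q) \<bullet> ((1 / \<beta>) *\<^sub>R (x - q)) \<le> f y"
proof -
  define I N where "I = (x - q) \<bullet> (y - q)" and "N = (norm (y - q))\<^sup>2"
  have q: "q \<in> Rn n" using prox_in_Rn[OF \<beta> x] by (simp add: q_def)
  have le: "f q + I / \<beta> \<le> f y + s * (N / (2 * \<beta>))" if s: "0 < s" "s < 1" for s
  proof -
    define z where "z = (1 - s) *\<^sub>R q + s *\<^sub>R y"
    have z: "z \<in> Rn n" unfolding z_def by (intro Rn_add Rn_scale q y)
    have square: "(norm (a - s *\<^sub>R b))\<^sup>2 = (norm a)\<^sup>2 - 2 * s * (a \<bullet> b) + s\<^sup>2 * (norm b)\<^sup>2"
      for a b :: fseq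
      unfolding power2_norm_eq_inner
      by (simp add: inner_diff_left inner_diff_right inner_commute power2_eq_square algebra_simps)
    have "x - z = (x - q) - s *\<^sub>R (y - q)" by (simp add: z_def algebra_simps)
    then have nz: "(norm (x - z))\<^sup>2 = (norm (x - q))\<^sup>2 - 2 * s * I + s\<^sup>2 * N"
      by (simp only: square I_def N_def)
    have "f q + 1 / (2 * \<beta>) * (norm (x - q))\<^sup>2 \<le> f z + 1 / (2 * \<beta>) * (norm (x - z))\<^sup>2"
      using prox_le[OF \<beta> x z] by (simp add: q_def)
    also have "1 / (2 * \<beta>) * (norm (x - z))\<^sup>2
        = 1 / (2 * \<beta>) * (norm (x - q))\<^sup>2 - s * (I / \<beta>) + s * (s * (N / (2 * \<beta>)))"
      using \<beta> unfolding nz by (simp add: field_simps power2_eq_square)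
    finally have "f q + s * (I / \<beta>) \<le> f z + s * (s * (N / (2 * \<beta>)))"
      by simp
    moreover have "f z \<le> (1 - s) * f q + s * f y"
      unfolding z_def using convex_onD[OF convex, of s q y] s q y by simp
    ultimately have "s * (f q + I / \<beta>) \<le> s * (f y + s * (N / (2 * \<beta>)))"
      by (simp only: distrib_left left_diff_distrib)
    then show ?thesis using s by simp
  qed
  have "((\<lambda>s. f y + s * (N / (2 * \<beta>))) \<longlongrightarrow> f y + 0 * (N / (2 * \<beta>))) (at_right 0)"
    by (intro tendsto_intros)
  moreover have "eventually (\<lambda>s. f q + I / \<beta> \<le> f y + s * (N / (2 * \<beta>))) (at_right (0::real))"
    using le by (auto simp: eventually_at_right_field intro!: exI[of _ 1])
  ultimately have "f q + I / \<beta> \<le> f y + 0 * (N / (2 * \<beta>))"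
    by (rule tendsto_lowerbound) simp
  then show ?thesis by (simp add: I_def inner_commute)
qed

text \<open>
  The two halves of differentiability with a \<open>1 / \<beta>\<close>-Lipschitz gradient. The upper bound is the
  definition of the envelope tested with the prox point of \<open>x\<close>. For the lower bound, \<open>f\<close> is
  replaced by its affine minorant at that prox point, whose envelope is affine with the same
  slope and agrees with the envelope of \<open>f\<close> at \<open>x\<close>.
\<close>

lemma moreau_env_upper:
  assumes \<beta>: "\<beta> > 0" and x: "x \<in> Rn n" and z: "z \<in> Rn n"
  shows "moreau_env n f \<beta> z \<le> moreau_env n f \<beta> x
    + (z - x) \<bullet> ((1 / \<beta>) *\<^sub>R (x - prox n f \<beta> x)) + 1 / (2 * \<beta>) * (norm (z - x))\<^sup>2"
proof -
  define q where "q = prox n f \<beta> x"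
  have "(norm (z - q))\<^sup>2 = (norm (x - q))\<^sup>2 + 2 * ((z - x) \<bullet> (x - q)) + (norm (z - x))\<^sup>2"
    unfolding power2_norm_eq_inner
    by (simp add: inner_diff_left inner_diff_right inner_commute algebra_simps)
  moreover have "moreau_env n f \<beta> z \<le> f q + 1 / (2 * \<beta>) * (norm (z - q))\<^sup>2"
    using moreau_env_le[OF \<beta> z] prox_in_Rn[OF \<beta> x] by (simp add: q_def)
  moreover have "(z - x) \<bullet> ((1 / \<beta>) *\<^sub>R (x - q)) = 1 / (2 * \<beta>) * (2 * ((z - x) \<bullet> (x - q)))"
    by simp
  ultimately show ?thesis
    unfolding moreau_env_eq[OF \<beta> x] q_def[symmetric] by (simp only: distrib_left)
qed

lemma moreau_env_lower:
  assumes \<beta>: "\<beta> > 0" and x: "x \<in> Rn n" and z: "z \<in> Rn n"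
  shows "moreau_env n f \<beta> x + (z - x) \<bullet> ((1 / \<beta>) *\<^sub>R (x - prox n f \<beta> x)) \<le> moreau_env n f \<beta> z"
proof -
  define q r where "q = prox n f \<beta> x" and "r = prox n f \<beta> z"
  have r: "r \<in> Rn n" using prox_in_Rn[OF \<beta> z] by (simp add: r_def)
  have sub: "f q + (r - q) \<bullet> ((1 / \<beta>) *\<^sub>R (x - q)) \<le> f r"
    using prox_subgradient[OF \<beta> x r] by (simp add: q_def)
  \<comment> \<open>Completing the square in the minimisation of the affine minorant plus the quadratic.\<close>
  have "(norm (x - q))\<^sup>2 + 2 * ((z - x) \<bullet> (x - q))
      = 2 * ((r - q) \<bullet> (x - q)) + (norm (z - r))\<^sup>2 - (norm ((z - r) - (x - q)))\<^sup>2"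
    unfolding power2_norm_eq_inner
    by (simp add: inner_diff_left inner_diff_right inner_commute algebra_simps)
  then have "(norm (x - q))\<^sup>2 + 2 * ((z - x) \<bullet> (x - q))
      \<le> 2 * ((r - q) \<bullet> (x - q)) + (norm (z - r))\<^sup>2"
    by simp
  then have "1 / (2 * \<beta>) * ((norm (x - q))\<^sup>2 + 2 * ((z - x) \<bullet> (x - q)))
      \<le> 1 / (2 * \<beta>) * (2 * ((r - q) \<bullet> (x - q)) + (norm (z - r))\<^sup>2)"
    using \<beta> by (intro mult_left_mono) auto
  with sub show ?thesis
    by (simp add: moreau_env_eq[OF \<beta> x] moreau_env_eq[OF \<beta> z] q_def[symmetric] r_def[symmetric]
        distrib_left)
qed

lemma grad_moreau_env:
  assumes \<beta>: "\<beta> > 0" and x: "x \<in> Rn n"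
  shows "grad n (moreau_env n f \<beta>) x = (1 / \<beta>) *\<^sub>R (x - prox n f \<beta> x)"
proof (rule grad_eqI)
  let ?g = "(1 / \<beta>) *\<^sub>R (x - prox n f \<beta> x)"
  show "?g \<in> Rn n" by (intro Rn_scale Rn_diff x prox_in_Rn \<beta>)
  show "(moreau_env n f \<beta> has_derivative (\<lambda>h. h \<bullet> ?g)) (at x within Rn n)"
  proof (rule has_derivativeI_sandwich[of 1])
    show "bounded_linear (\<lambda>h. h \<bullet> ?g)" by (rule bounded_linear_inner_left)
    show "norm (moreau_env n f \<beta> y - moreau_env n f \<beta> x - (y - x) \<bullet> ?g) / norm (y - x)
        \<le> 1 / (2 * \<beta>) * norm (y - x)" if "y \<in> Rn n" "y \<noteq> x" for y
      using moreau_env_upper[OF \<beta> x that(1)] moreau_env_lower[OF \<beta> x that(1)] that(2)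
      by (simp add: pos_divide_le_eq mult.assoc power2_eq_square[symmetric])
    have "((\<lambda>y. 1 / (2 * \<beta>) * norm (y - x)) \<longlongrightarrow> 1 / (2 * \<beta>) * norm (x - x)) (at x within Rn n)"
      by (intro tendsto_intros)
    then show "((\<lambda>y. 1 / (2 * \<beta>) * norm (y - x)) \<longlongrightarrow> 0) (at x within Rn n)" by simp
  qed simp
qed (rule x)

text \<open>The gradient is a subgradient of \<open>f\<close> at the prox point, hence bounded by \<open>L\<close>.\<close>

lemma norm_diff_prox_le:
  assumes \<beta>: "\<beta> > 0" and x: "x \<in> Rn n"
  shows "norm (x - prox n f \<beta> x) \<le> \<beta> * L"
proof -
  define q where "q = prox n f \<beta> x"
  define g where "g = (1 / \<beta>) *\<^sub>R (x - q)"
  have q: "q \<in> Rn n" using prox_in_Rn[OF \<beta> x] by (simp add: q_def)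
  have qg: "q + g \<in> Rn n" unfolding g_def by (intro Rn_add Rn_scale Rn_diff q x)
  have "f q + g \<bullet> g \<le> f (q + g)"
    using prox_subgradient[OF \<beta> x qg] by (simp add: q_def[symmetric] g_def[symmetric])
  moreover have "f (q + g) - f q \<le> L * norm g"
    using lipschitzD[OF qg q] by simp
  ultimately have "norm g * norm g \<le> L * norm g"
    by (simp add: power2_eq_square[symmetric] power2_norm_eq_inner)
  then have "norm g \<le> L"
    using lipschitz_on_nonneg[OF lipschitz] by (cases "norm g = 0") auto
  moreover have "norm g = norm (x - q) / \<beta>"
    using \<beta> by (simp add: g_def)
  ultimately show ?thesis
    using \<beta> by (simp add: q_def[symmetric] pos_divide_le_eq mult.commute)
qed

lemma le_moreau_env:
  assumes \<beta>: "\<beta> > 0" and x: "x \<in> Rn n"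
  shows "f x \<le> moreau_env n f \<beta> x + \<beta> * L\<^sup>2 / 2"
proof -
  define r where "r = norm (x - prox n f \<beta> x)"
  have "f x - f (prox n f \<beta> x) \<le> L * r"
    using lipschitzD[OF x prox_in_Rn[OF \<beta> x]] by (simp add: r_def)
  moreover have "L * r \<le> 1 / (2 * \<beta>) * r\<^sup>2 + \<beta> * L\<^sup>2 / 2"
    using \<beta> zero_le_power2[of "r - \<beta> * L"]
    by (simp add: field_simps power2_eq_square)
  ultimately show ?thesis
    by (simp add: moreau_env_eq[OF \<beta> x] r_def[symmetric])
qed

text \<open>
  The cost of decreasing the smoothing parameter from \<open>\<beta>\<close> to \<open>\<beta>'\<close>: the old prox point remains
  a candidate for the new envelope. The error is proportional to \<open>\<beta> - \<beta>'\<close> and not to \<open>\<beta>\<close>, so it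
  is of lower order when consecutive parameters are close.
\<close>

lemma moreau_env_decrease_parameter:
  assumes \<beta>: "0 < \<beta>'" "\<beta>' \<le> \<beta>" and x: "x \<in> Rn n"
  shows "moreau_env n f \<beta>' x \<le> moreau_env n f \<beta> x + L\<^sup>2 / 2 * (\<beta> * (\<beta> / \<beta>' - 1))"
proof -
  define q where "q = prox n f \<beta> x"
  have \<beta>0: "\<beta> > 0" using \<beta> by simp
  have "moreau_env n f \<beta>' x \<le> f q + 1 / (2 * \<beta>') * (norm (x - q))\<^sup>2"
    using moreau_env_le[OF \<beta>(1) x] prox_in_Rn[OF \<beta>0 x] by (simp add: q_def)
  also have "\<dots> = moreau_env n f \<beta> x + (1 / (2 * \<beta>') - 1 / (2 * \<beta>)) * (norm (x - q))\<^sup>2"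
    by (simp add: moreau_env_eq[OF \<beta>0 x] q_def[symmetric] left_diff_distrib)
  also have "\<dots> \<le> moreau_env n f \<beta> x + (1 / (2 * \<beta>') - 1 / (2 * \<beta>)) * (\<beta> * L)\<^sup>2"
    using \<beta> norm_diff_prox_le[OF \<beta>0 x]
    by (intro add_left_mono mult_left_mono power_mono) (auto simp: q_def frac_le)
  also have "(1 / (2 * \<beta>') - 1 / (2 * \<beta>)) * (\<beta> * L)\<^sup>2 = L\<^sup>2 / 2 * (\<beta> * (\<beta> / \<beta>' - 1))"
    using \<beta> \<beta>0 by (simp add: field_simps power2_eq_square)
  finally show ?thesis .
qed

end

section \<open>Convergence of HCGS\<close>

text \<open>
  The factor \<open>t / (t + 2)\<close> vanishes at \<open>t = 0\<close>, which erases the initial gap; from then on the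
  bound is carried forward by \<open>(t + 1) \<surd>(t + 3) \<le> (t + 2) \<surd>(t + 2)\<close>.
\<close>

lemma gap_recurrence_bound:
  fixes h :: "nat \<Rightarrow> real"
  assumes c: "c \<ge> 0"
    and step: "\<And>t. h (Suc t) \<le> real t / (real t + 2) * h t + c / ((real t + 2) * sqrt (real t + 2))"
  shows "h (Suc t) \<le> c / sqrt (real t + 3)"
proof (induction t)
  have shrink: "(a + 1) * sqrt (a + 3) \<le> (a + 2) * sqrt (a + 2)" if "a \<ge> 0" for a :: real
  proof (rule power2_le_imp_le)
    show "((a + 1) * sqrt (a + 3))\<^sup>2 \<le> ((a + 2) * sqrt (a + 2))\<^sup>2"
      using that by (simp add: power_mult_distrib) (simp add: power2_eq_square algebra_simps)
  qed (use that in simp)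
  have advance: "h (Suc t) \<le> c / sqrt (real t + 3)"
    if "real t * h t \<le> real t * (c / sqrt (real t + 2))" for t
  proof -
    let ?s = "sqrt (real t + 2)"
    have "h (Suc t) \<le> real t * h t / (real t + 2) + c / ((real t + 2) * ?s)"
      using step[of t] by simp
    also have "\<dots> \<le> real t * (c / ?s) / (real t + 2) + c / ((real t + 2) * ?s)"
      using that by (intro add_right_mono divide_right_mono) auto
    also have "\<dots> = c * ((real t + 1) / ((real t + 2) * ?s))"
      by (simp add: add_divide_distrib[symmetric] distrib_left mult.commute)
    also have "\<dots> \<le> c * (1 / sqrt (real t + 3))"
    proof (intro mult_left_mono c)
      have "a / b \<le> 1 / d" if "a * d \<le> b" "b > 0" "d > 0" for a b d :: real
        using that by (simp add: field_simps)
      then show "(real t + 1) / ((real t + 2) * ?s) \<le> 1 / sqrt (real t + 3)"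
        using shrink[of "real t"] by simp
    qed
    finally show ?thesis by simp
  qed
  {
    case 0
    show ?case by (rule advance) simp
  next
    case (Suc t)
    then show ?case by (intro advance mult_left_mono) (auto simp: add.commute)
  }
qed

lemma hcgs_iterate_in:
  assumes run: "hcgs_run n C f \<gamma> \<beta> x v" and C: "convex C" and \<gamma>: "\<And>t. 0 \<le> \<gamma> t \<and> \<gamma> t \<le> 1"
  shows "x t \<in> C"
proof (induction t)
  case 0
  then show ?case using run by (simp add: hcgs_run_def extreme_point_of_def)
next
  case (Suc t)
  have "v t \<in> C" using run by (simp add: hcgs_run_def extreme_point_of_def)
  moreover have "x (Suc t) = (1 - \<gamma> t) *\<^sub>R x t + \<gamma> t *\<^sub>R v t"
    using run by (simp add: hcgs_run_def algebra_simps)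
  ultimately show ?case
    using Suc \<gamma>[of t] C by (auto intro!: convexD)
qed

lemma iterate_cardinality_le: "iterate_cardinality \<gamma> x0 v t \<le> Suc t"
proof -
  have "hcgs_weight \<gamma> x0 v t u = 0" if "u \<notin> insert x0 (v ` {..<t})" for u
    using that by (induction t) (auto simp: lessThan_Suc)
  then have "{u. hcgs_weight \<gamma> x0 v t u > 0} \<subseteq> insert x0 (v ` {..<t})"
    by force
  then have "iterate_cardinality \<gamma> x0 v t \<le> card (insert x0 (v ` {..<t}))"
    unfolding iterate_cardinality_def by (intro card_mono) auto
  also have "\<dots> \<le> Suc (card (v ` {..<t}))"
    by (simp add: card_insert_if)
  also have "\<dots> \<le> Suc t"
    using card_image_le[of "{..<t}" v] by simp
  finally show ?thesis .
qed

context lipschitz_convex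
begin

text \<open>
  One Frank-Wolfe step on a fixed envelope: smoothness bounds the new value by the linear model
  plus a quadratic error, the oracle makes the linear model no worse than at \<open>z\<close>, and there it
  lies below the envelope by convexity.
\<close>

lemma frank_wolfe_step:
  assumes \<beta>: "\<beta> > 0" and C: "C \<subseteq> Rn n" "bounded C" and y: "y \<in> C" and z: "z \<in> C"
    and \<gamma>: "0 \<le> \<gamma>"
    and v: "is_arg_min (\<lambda>u. u \<bullet> grad n (moreau_env n f \<beta>) y) (\<lambda>u. u \<in> C) v"
  shows "moreau_env n f \<beta> (y + \<gamma> *\<^sub>R (v - y))
      \<le> (1 - \<gamma>) * moreau_env n f \<beta> y + \<gamma> * f z + (\<gamma> * diameter C)\<^sup>2 / (2 * \<beta>)"
proof -
  define g where "g = (1 / \<beta>) *\<^sub>R (y - prox n f \<beta> y)"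
  have g: "grad n (moreau_env n f \<beta>) y = g"
    unfolding g_def using C y by (intro grad_moreau_env \<beta>) auto
  have vC: "v \<in> C" and "v \<bullet> g \<le> z \<bullet> g"
    using v z by (auto simp: is_arg_min_def g not_less)
  moreover have "moreau_env n f \<beta> y + (z - y) \<bullet> g \<le> moreau_env n f \<beta> z"
    unfolding g_def using C y z by (intro moreau_env_lower \<beta>) auto
  moreover have "moreau_env n f \<beta> z \<le> f z"
    using C z by (intro moreau_env_le_self \<beta>) auto
  ultimately have "(v - y) \<bullet> g \<le> f z - moreau_env n f \<beta> y"
    by (simp add: inner_diff_left)
  then have linear: "\<gamma> * ((v - y) \<bullet> g) \<le> \<gamma> * (f z - moreau_env n f \<beta> y)"
    using \<gamma> by (intro mult_left_mono)
  have "norm (v - y) \<le> diameter C"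
    using diameter_bounded_bound[OF C(2) vC y] by (simp add: dist_norm)
  then have quadratic: "1 / (2 * \<beta>) * (norm (\<gamma> *\<^sub>R (v - y)))\<^sup>2 \<le> 1 / (2 * \<beta>) * (\<gamma> * diameter C)\<^sup>2"
    using \<gamma> \<beta> by (intro mult_left_mono power_mono) (auto intro: mult_left_mono)
  have "y + \<gamma> *\<^sub>R (v - y) \<in> Rn n"
    using C y vC by (intro Rn_add Rn_scale Rn_diff) auto
  then have "moreau_env n f \<beta> (y + \<gamma> *\<^sub>R (v - y))
      \<le> moreau_env n f \<beta> y + \<gamma> * ((v - y) \<bullet> g) + 1 / (2 * \<beta>) * (norm (\<gamma> *\<^sub>R (v - y)))\<^sup>2"
    using moreau_env_upper[OF \<beta>, of y "y + \<gamma> *\<^sub>R (v - y)"] C y by (auto simp: g_def)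
  also have "\<dots> \<le> moreau_env n f \<beta> y + \<gamma> * (f z - moreau_env n f \<beta> y)
      + 1 / (2 * \<beta>) * (\<gamma> * diameter C)\<^sup>2"
    using linear quadratic by simp
  finally show ?thesis by (simp add: algebra_simps)
qed

text \<open>
  The choice \<open>\<beta>\<^sub>t \<sim> D / (L \<surd>t)\<close> balances the three errors: with \<open>s = \<surd>(t + 2)\<close>, the quadratic
  error of a step is \<open>D L / s\<^sup>3\<close>, the change of envelope costs at most half of that, and the
  remaining gap between \<open>f\<close> and its envelope is \<open>D L / s\<close>.
\<close>

lemma hcgs_convergence:
  assumes L: "L > 0" and C: "C \<subseteq> Rn n" "compact C" "convex C" and D: "diameter C > 0"
    and z: "z \<in> C"
    and \<gamma>: "\<And>t. \<gamma> t = 2 / (real t + 2)"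
    and \<beta>: "\<And>t. \<beta> t = 2 * diameter C / (L * sqrt (real t + 2))"
    and run: "hcgs_run n C f \<gamma> \<beta> x v"
  shows "f (x (Suc t)) - f z \<le> 5 / 2 * diameter C * L / sqrt (real t + 3)"
proof -
  let ?D = "diameter C"
  define h where "h = (\<lambda>t. moreau_env n f (\<beta> t) (x t) - f z)"
  have \<beta>_pos: "\<beta> t > 0" for t using L D by (simp add: \<beta>)
  have xC: "x t \<in> C" for t
    by (rule hcgs_iterate_in[OF run C(3)]) (simp add: \<gamma>)
  then have xR: "x t \<in> Rn n" for t using C by auto
  have "h (Suc t) \<le> real t / (real t + 2) * h t
      + (3 / 2 * ?D * L) / ((real t + 2) * sqrt (real t + 2))" for t
  proof -
    define s s' where "s = sqrt (real t + 2)" and "s' = sqrt (real t + 3)"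
    have s: "s > 0" "s \<le> s'" "s\<^sup>2 = real t + 2" "s'\<^sup>2 = real t + 3"
      by (auto simp: s_def s'_def)
    have "s' > 0" using s by simp
    have \<beta>_s: "\<beta> t = 2 * ?D / (L * s)" "\<beta> (Suc t) = 2 * ?D / (L * s')"
      by (simp_all add: \<beta> s_def s'_def add.commute)
    have "\<beta> (Suc t) \<le> \<beta> t"
      unfolding \<beta>_s using L D s by (intro divide_left_mono mult_left_mono) auto
    then have "moreau_env n f (\<beta> (Suc t)) (x (Suc t)) \<le> moreau_env n f (\<beta> t) (x (Suc t))
        + L\<^sup>2 / 2 * (\<beta> t * (\<beta> t / \<beta> (Suc t) - 1))"
      by (intro moreau_env_decrease_parameter \<beta>_pos xR)
    also have "L\<^sup>2 / 2 * (\<beta> t * (\<beta> t / \<beta> (Suc t) - 1)) = ?D * L * (s' - s) / s\<^sup>2"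
      unfolding \<beta>_s using L D s(1) \<open>s' > 0\<close> by (simp add: field_simps power2_eq_square)
    also have "\<dots> \<le> ?D * L * (1 / (2 * s)) / s\<^sup>2"
    proof (intro divide_right_mono mult_left_mono)
      have "(s' - s) * (2 * s) \<le> (s' - s) * (s' + s)"
        using s by (intro mult_left_mono) auto
      also have "\<dots> = 1" using s by (simp add: algebra_simps power2_eq_square)
      finally show "s' - s \<le> 1 / (2 * s)" using s by (simp add: field_simps)
    qed (use L D in auto)
    also have "moreau_env n f (\<beta> t) (x (Suc t))
        \<le> (1 - \<gamma> t) * moreau_env n f (\<beta> t) (x t) + \<gamma> t * f z + (\<gamma> t * ?D)\<^sup>2 / (2 * \<beta> t)"
    proof -
      have "x (Suc t) = x t + \<gamma> t *\<^sub>R (v t - x t)"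
        and v: "is_arg_min (\<lambda>u. u \<bullet> grad n (moreau_env n f (\<beta> t)) (x t)) (\<lambda>u. u \<in> C) (v t)"
        using run by (auto simp: hcgs_run_def)
      moreover have "0 \<le> \<gamma> t" by (simp add: \<gamma>)
      ultimately show ?thesis
        using frank_wolfe_step[OF \<beta>_pos C(1) compact_imp_bounded[OF C(2)] xC z _ v]
        by simp
    qed
    also have "(\<gamma> t * ?D)\<^sup>2 / (2 * \<beta> t) = ?D * L / (s\<^sup>2 * s)"
      unfolding \<gamma> \<beta>_s s(3)[symmetric] using L D s(1) by (simp add: field_simps power2_eq_square)
    finally have "h (Suc t)
        \<le> (1 - \<gamma> t) * h t + (?D * L / (s\<^sup>2 * s) + ?D * L * (1 / (2 * s)) / s\<^sup>2)"
      unfolding h_def left_diff_distrib right_diff_distrib by linarith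
    also have "?D * L / (s\<^sup>2 * s) + ?D * L * (1 / (2 * s)) / s\<^sup>2 = (3 / 2 * ?D * L) / (s\<^sup>2 * s)"
      using s(1) by (simp add: field_simps power2_eq_square)
    finally have "h (Suc t) \<le> (1 - \<gamma> t) * h t + (3 / 2 * ?D * L) / (s\<^sup>2 * s)" .
    moreover have "1 - \<gamma> t = real t / (real t + 2)" by (simp add: \<gamma> field_simps)
    ultimately show ?thesis by (simp add: s(3)) (simp add: s_def)
  qed
  then have "h (Suc t) \<le> (3 / 2 * ?D * L) / sqrt (real t + 3)"
    using D L by (intro gap_recurrence_bound) auto
  moreover have "f (x (Suc t)) - f z \<le> h (Suc t) + \<beta> (Suc t) * L\<^sup>2 / 2"
    using le_moreau_env[OF \<beta>_pos xR] by (simp add: h_def)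
  moreover have "\<beta> (Suc t) * L\<^sup>2 / 2 = ?D * L / sqrt (real t + 3)"
    using L by (simp add: \<beta> power2_eq_square add.commute)
  ultimately show ?thesis by (simp add: field_simps)
qed

end

section \<open>Approximate Caratheodory bound\<close>

theorem corollary6p5:
  shows "\<exists>K>0::real. \<forall>(n::nat) (C::fseq set) (xstar::fseq) (p::real) (\<epsilon>::real)
      (\<gamma>::nat \<Rightarrow> real) (\<beta>::nat \<Rightarrow> real) (x::nat \<Rightarrow> fseq) (v::nat \<Rightarrow> fseq).
    C \<subseteq> Rn n \<longrightarrow> compact C \<longrightarrow> convex C \<longrightarrow> diameter C > 0 \<longrightarrow>
    xstar \<in> C \<longrightarrow> 1 \<le> p \<longrightarrow> p < 2 \<longrightarrow> \<epsilon> > 0 \<longrightarrow>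
    (\<forall>t. \<gamma> t = 2 / (real t + 2)) \<longrightarrow>
    (\<forall>t. \<beta> t = 2 * diameter C / (real n powr (1 / p - 1 / 2) * sqrt (real t + 2))) \<longrightarrow>
    hcgs_run n C (\<lambda>y. lp_norm n p (y - xstar)) \<gamma> \<beta> x v \<longrightarrow>
    (\<exists>t. x t \<in> C \<and> lp_norm n p (x t - xstar) \<le> \<epsilon> \<and>
         real (iterate_cardinality \<gamma> (x 0) v t)
           \<le> K * max 1 (real n powr ((2 - p) / p) * (diameter C)\<^sup>2 / \<epsilon>\<^sup>2))"
proof (rule exI[of _ 10], intro conjI allI impI)
  fix n C xstar p \<epsilon> \<gamma> \<beta> and x v :: "nat \<Rightarrow> fseq"
  assume C: "C \<subseteq> Rn n" "compact C" "convex C" and D: "diameter C > 0"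
    and xstar: "xstar \<in> C" and p: "1 \<le> p" "p < 2" and \<epsilon>: "\<epsilon> > (0::real)"
    and \<gamma>: "\<forall>t. \<gamma> t = 2 / (real t + 2)"
    and \<beta>: "\<forall>t. \<beta> t = 2 * diameter C / (real n powr (1 / p - 1 / 2) * sqrt (real t + 2))"
    and run: "hcgs_run n C (\<lambda>y. lp_norm n p (y - xstar)) \<gamma> \<beta> x v"
  define L where "L = real n powr (1 / p - 1 / 2)"
  define Q where "Q = real n powr ((2 - p) / p) * (diameter C)\<^sup>2 / \<epsilon>\<^sup>2"
  interpret lipschitz_convex n "\<lambda>y. lp_norm n p (y - xstar)" L
    unfolding L_def using p
    by unfold_locales (auto intro: convex_on_lp_norm_diff lipschitz_on_lp_norm_diff)
  have "n \<noteq> 0"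
  proof
    assume "n = 0"
    then have "coord u i = 0" if "u \<in> C" for u i
      using C that by (auto simp: Rn_def)
    then have "C \<subseteq> {0}" by (auto intro: fseq_eqI)
    then have "diameter C = 0" by (auto dest: subset_singletonD)
    then show False using D by simp
  qed
  then have L: "L > 0" by (simp add: L_def)
  have "L\<^sup>2 = real n powr ((2 - p) / p)"
    using p by (simp add: L_def power2_eq_square powr_add[symmetric]) (simp add: field_simps)
  then have Q: "Q = (diameter C * L / \<epsilon>)\<^sup>2"
    by (simp add: Q_def power_mult_distrib power_divide mult.commute)
  \<comment> \<open>The error \<open>5 D L / (2 \<surd>(t + 3))\<close> of the iterate \<open>t + 1\<close> is at most \<open>\<epsilon>\<close> as soon as
    \<open>t + 3 \<ge> (5 D L / (2 \<epsilon>))\<^sup>2 = 25 Q / 4\<close>.\<close>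
  define t where "t = nat \<lceil>25 / 4 * Q\<rceil>"
  have t: "25 / 4 * Q \<le> real t" "real t \<le> 25 / 4 * Q + 1"
    unfolding t_def using Q by (auto simp: real_nat_ceiling_ge intro: order.trans[OF of_nat_ceiling])
  have "lp_norm n p (x (Suc t) - xstar) - lp_norm n p (xstar - xstar)
      \<le> 5 / 2 * diameter C * L / sqrt (real t + 3)"
    using L C D xstar \<gamma> \<beta> run by (intro hcgs_convergence) (auto simp: L_def)
  also have "\<dots> \<le> \<epsilon>"
  proof -
    have "(5 / 2 * diameter C * L / \<epsilon>)\<^sup>2 = 25 / 4 * Q"
      by (simp add: Q power_mult_distrib power_divide)
    then have "5 / 2 * diameter C * L / \<epsilon> \<le> sqrt (real t + 3)"
      using t by (intro real_le_rsqrt) simp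
    then show ?thesis using \<epsilon> by (simp add: field_simps)
  qed
  finally have "lp_norm n p (x (Suc t) - xstar) \<le> \<epsilon>"
    by (simp add: lp_norm_def)
  moreover have "x (Suc t) \<in> C"
    by (rule hcgs_iterate_in[OF run C(3)]) (simp add: \<gamma>)
  moreover have "real (iterate_cardinality \<gamma> (x 0) v (Suc t)) \<le> 10 * max 1 Q"
  proof -
    have "real (iterate_cardinality \<gamma> (x 0) v (Suc t)) \<le> real t + 2"
      using iterate_cardinality_le[of \<gamma> "x 0" v "Suc t"] by linarith
    then show ?thesis using t by linarith
  qed
  ultimately show "\<exists>t. x t \<in> C \<and> lp_norm n p (x t - xstar) \<le> \<epsilon> \<and>
      real (iterate_cardinality \<gamma> (x 0) v t)
        \<le> 10 * max 1 (real n powr ((2 - p) / p) * (diameter C)\<^sup>2 / \<epsilon>\<^sup>2)"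
    unfolding Q_def by blast
qed simp

end
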